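(* Let $f:X\times U\times W\to X$ be the plant map, $\tilde f:X\times U\to X$ the prediction map, $m>1$ the buffer length, and $\mu:X\times\{0,\ldots,m-1\}\to U$ the input sequence generator of a prediction consistent delay compensation scheme (all as in the context). Assume the following. (A) (Prediction error and perturbation bounds.) (i) There is a function $\varepsilon:[0,\infty)^2\to[0,\infty)$, continuous and monotonically increasing in both arguments, with $$\|\tilde x(n,n_0,\tilde x_0,u)-x(n,n_0,x_0,u,0)\|\le\varepsilon(n-n_0,\|\tilde x_0-x_0\|)$$ for all integers $n\ge n_0$, all $x_0,\tilde x_0\in X$ and all input sequences $u$ with values in $U$. (ii) There is a continuous function $\eta:[0,\infty)^2\to[0,\infty)$, monotonically increasing in its first argument and with $\eta(n,\cdot)\in\mathcal K$ for all $n\ge 0$, such that $$\|x(n,n_0,x_0,u,0)-x(n,n_0,x_0,u,w)\|\le\eta(n-n_0,\|w\|_\infty)$$ for all integers $n\ge n_0$, all $x_0\in X$, all input sequences $u$ with values in $U$ and all perturbation sequences $w$ with values in $W$. (B) (ISS of the auxiliary non-delayed system.) There are $\beta\in\mathcal{KL}$ and $\gamma_w,\gamma_v\in\mathcal K_\infty$ such that the solutions $x_a$ of the auxiliary system defined in the context satisfy $$\|x_a(n,x_0,v,w)\|\le\max\{\beta(\|x_0\|,n),\ \gamma_w(\|w\|_\infty),\ \gamma_v(\|v\|_\infty)\}$$ for all $n\in\mathbb N_0$, each initial value $x_0\in X$, each admissible switching sequence $(\sigma_i)_{i\in\mathbb N_0}$, each perturbation sequence $w$ with values in $W$, and each admissible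 measurement error sequence $v$. Then every trajectory $x_{cl}(\cdot)=x_{cl}(\cdot,x_0,\sigma_\cdot,\tau,w)$ of the closed loop system with delay compensation satisfies $$\|x_{cl}(n,x_0,\sigma_\cdot,\tau,w)\|\le\max\Big\{\beta(\|x_0\|,n),\ \gamma_w(\|w\|_\infty),\ \gamma_v\Big(\varepsilon(\tau_\infty+\Delta^\sigma_\infty,0)+\eta(\tau_\infty+\Delta^\sigma_\infty,\|w\|_\infty)\Big)\Big\}$$ for all $x_0\in X$, all $n\in\mathbb N_0$ and all perturbation sequences $w$ with values in $W$, where $\tau_\infty=\max_{i\in\mathbb N_0}\tau(\sigma_i)$ and $\Delta^\sigma_\infty=\max_{i\in\mathbb N_0}(\sigma_{i+1}-\sigma_i)$.
   Context: **Spaces and comparison functions.** $X\subseteq\mathbb R^{d}$ and $U\subseteq\mathbb R^{l}$ are sets and $W$ is a subset of a normed space with $0\in W$. $\mathcal K$ is the set of continuous strictly increasing $\alpha:[0,\infty)\to[0,\infty)$ with $\alpha(0)=0$. $\mathcal K_\infty$ is the set of unbounded $\alpha\in\mathcal K$. $\mathcal{KL}$ is the set of continuous $\beta:[0,\infty)\times[0,\infty)\to[0,\infty)$ with $\beta(\cdot,t)\in\mathcal K$ for each $t$ and $\beta(r,\cdot)$ decreasing to $0$ for each $r$. "Monotonically increasing" means nondecreasing. For a sequence $z$, $\|z\|_\infty$ is the supremum of $\|z(n)\|$ over all times at which $z$ is defined; inequalities whose right-hand side involves an infinite supremum are regarded as trivially true. **Plant and predictor.** For $n\ge n_0$, $x(n,n_0,x_0,u,w)$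 is the value at time $n$ of the solution of $x(k+1)=f(x(k),u(k),w(k))$ with $x(n_0)=x_0$; writing $0$ for $w$ means $w\equiv 0$. Similarly, $\tilde x(n,n_0,\tilde x_0,\tilde u)$ is the value at time $n$ of the solution of $\tilde x(k+1)=\tilde f(\tilde x(k),\tilde u(k))$ with $\tilde x(n_0)=\tilde x_0$. **Switching times and delays.** An admissible switching sequence is a strictly increasing integer sequence $(\sigma_i)_{i\in\mathbb N_0}$ with $\sigma_0=0$ and $\sigma_{i+1}-\sigma_i\le m$. Here $\sigma_i$ is the time at which the actuator switches to the $i$-th control sequence it uses. The delays $\tau(\sigma_i)\in\mathbb N_0$ are bounded in $i$. The control sequence started at $\sigma_i$ was computed from the state measured at time $\sigma_i-\tau(\sigma_i)$, which may be negative. **Closed loop system with delay compensation.** The map $\mu(\xi,0),\ldots,\mu(\xi,m-1)$ gives the control sequence sent to the actuator for a predicted state $\xi\in X$ (for example generated by forward-predicting a static state feedback with $\tilde f$, or by model predictive control). A closed loop trajectory consists of sequences $x_{cl}(n)\in X$, $u(n)\in U$, $w(n)\in W$, defined for integers $n\ge-\tau_\infty$, with $x_{cl}(0)=x_0$ and $$x_{cl}(n+1)=f(x_{cl}(n),u(n),w(n))\quad\text{for all } n\ge-\tau_\infty,$$ where the inputs $u(n)\in U$ for $n<0$ are arbitrary past inputs, and for all $i\in\mathbb N_0$ and $n\in\{\sigma_i,\ldots,\sigma_{i+1}-1\}$ $$u(n)=\mu(\tilde x_{cl}(\sigma_i),\,n-\sigma_i),\qquad \tilde x_{cl}(\sigma_i)=\tilde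 x\big(\sigma_i,\ \sigma_i-\tau(\sigma_i),\ x_{cl}(\sigma_i-\tau(\sigma_i)),\ \tilde u\big).$$ The scheme is *prediction consistent*: the control sequence $\tilde u$ used in the predictions coincides with the control sequence $u$ actually applied to the plant, i.e. $\tilde u(k)=u(k)$ for all times $k$ involved. The trajectory for $n\ge 0$ is denoted $x_{cl}(n,x_0,\sigma_\cdot,\tau,w)$. **Auxiliary non-delayed system.** Given $x_0\in X$, an admissible switching sequence $(\sigma_i)$, a sequence $w:\mathbb N_0\to W$, and values $v(\sigma_i)$, $i\in\mathbb N_0$, the solution $x_a(n)=x_a(n,x_0,v,w)$, $n\in\mathbb N_0$, is defined by $x_a(0)=x_0$ and $$x_a(n+1)=f\big(x_a(n),\ \mu(x_a(\sigma_i)+v(\sigma_i),\,n-\sigma_i),\ w(n)\big),\quad n\in\{\sigma_i,\ldots,\sigma_{i+1}-1\},\ i\in\mathbb N_0.$$ The values $v(\sigma_i)$ are free, subject to $x_a(\sigma_i)+v(\sigma_i)\in X$. At the remaining times $v$ is determined by $$v(n)=\tilde x\big(n,\ \sigma_i,\ x_a(\sigma_i)+v(\sigma_i),\ \tilde u\big)-x_a(n),\quad \sigma_i<n<\sigma_{i+1},$$ where $\tilde u(k)=\mu(x_a(\sigma_i)+v(\sigma_i),k-\sigma_i)$ for $k\in\{\sigma_i,\ldots,\sigma_{i+1}-1\}$; that is, $v(n)$ is the difference between the predicted and the actual state. A sequence $v:\mathbb N_0\to\mathbb R^d$ arising in this way is called an admissible measurement error sequence. *)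

theory Defs
  imports "HOL-Analysis.Analysis"
begin

text \<open>
  Times are integers throughout. A sequence that is only defined on a set of times \<open>T\<close> is a total
  function on \<open>int\<close> whose values outside \<open>T\<close> are never constrained nor used.
  Functions on \<open>[0,\<infinity>)\<close> are likewise total on \<open>real\<close>, with all conditions restricted to \<open>{0..}\<close>.
\<close>

definition class_K :: "(real \<Rightarrow> real) \<Rightarrow> bool" where
  "class_K \<alpha> \<longleftrightarrow> (\<forall>r\<ge>0. \<alpha> r \<ge> 0) \<and> continuous_on {0..} \<alpha> \<and> strict_mono_on {0..} \<alpha> \<and> \<alpha> 0 = 0"

definition class_K_inf :: "(real \<Rightarrow> real) \<Rightarrow> bool" where
  "class_K_inf \<alpha> \<longleftrightarrow> class_K \<alpha> \<and> \<not> bdd_above (\<alpha> ` {0..})"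

definition class_KL :: "(real \<Rightarrow> real \<Rightarrow> real) \<Rightarrow> bool" where
  "class_KL \<beta> \<longleftrightarrow>
     continuous_on ({0..} \<times> {0..}) (\<lambda>(r, t). \<beta> r t) \<and>
     (\<forall>t\<ge>0. class_K (\<lambda>r. \<beta> r t)) \<and>
     (\<forall>r\<ge>0. antimono_on {0..} (\<beta> r) \<and> (\<beta> r \<longlongrightarrow> 0) at_top)"

text \<open>Only meaningful if \<open>z ` T\<close> is bounded; an inequality whose right-hand side contains
  \<open>sup_norm T z\<close> is therefore always stated under the premise \<open>bounded (z ` T)\<close>.\<close>
definition sup_norm :: "int set \<Rightarrow> (int \<Rightarrow> 'a::real_normed_vector) \<Rightarrow> real" where
  "sup_norm T z = (SUP n\<in>T. norm (z n))"

primrec iterate :: "(int \<Rightarrow> 'x \<Rightarrow> 'x) \<Rightarrow> int \<Rightarrow> 'x \<Rightarrow> nat \<Rightarrow> 'x" where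
  "iterate g n0 x0 0 = x0"
| "iterate g n0 x0 (Suc k) = g (n0 + int k) (iterate g n0 x0 k)"

text \<open>\<open>x(n, n0, x0, u, w)\<close> and its analogue for the predictor, for \<open>n \<ge> n0\<close>.\<close>
definition plant_sol ::
  "('x \<Rightarrow> 'u \<Rightarrow> 'w \<Rightarrow> 'x) \<Rightarrow> int \<Rightarrow> int \<Rightarrow> 'x \<Rightarrow> (int \<Rightarrow> 'u) \<Rightarrow> (int \<Rightarrow> 'w) \<Rightarrow> 'x" where
  "plant_sol f n n0 x0 u w = iterate (\<lambda>k x. f x (u k) (w k)) n0 x0 (nat (n - n0))"

definition pred_sol ::
  "('x \<Rightarrow> 'u \<Rightarrow> 'x) \<Rightarrow> int \<Rightarrow> int \<Rightarrow> 'x \<Rightarrow> (int \<Rightarrow> 'u) \<Rightarrow> 'x" where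
  "pred_sol ft n n0 x0 u = iterate (\<lambda>k x. ft x (u k)) n0 x0 (nat (n - n0))"

definition admissible_switching :: "nat \<Rightarrow> (nat \<Rightarrow> int) \<Rightarrow> bool" where
  "admissible_switching m \<sigma> \<longleftrightarrow>
     strict_mono \<sigma> \<and> \<sigma> 0 = 0 \<and> (\<forall>i. \<sigma> (Suc i) - \<sigma> i \<le> int m)"

definition bounded_delays :: "(nat \<Rightarrow> int) \<Rightarrow> (int \<Rightarrow> nat) \<Rightarrow> bool" where
  "bounded_delays \<sigma> \<tau> \<longleftrightarrow> bdd_above (range (\<lambda>i. \<tau> (\<sigma> i)))"

text \<open>Both maxima are over finite sets, by boundedness of the delays and by
  \<open>0 < \<sigma> (Suc i) - \<sigma> i \<le> m\<close>, respectively.\<close>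
definition tau_inf :: "(nat \<Rightarrow> int) \<Rightarrow> (int \<Rightarrow> nat) \<Rightarrow> nat" where
  "tau_inf \<sigma> \<tau> = Max (range (\<lambda>i. \<tau> (\<sigma> i)))"

definition delta_inf :: "(nat \<Rightarrow> int) \<Rightarrow> int" where
  "delta_inf \<sigma> = Max (range (\<lambda>i. \<sigma> (Suc i) - \<sigma> i))"

text \<open>The predicted state at time \<open>s\<close>, computed from the state measured at \<open>s - \<tau> s\<close>
  with the control sequence \<open>ut\<close> assumed by the predictor.\<close>
definition predicted_state ::
  "('x \<Rightarrow> 'u \<Rightarrow> 'x) \<Rightarrow> (int \<Rightarrow> nat) \<Rightarrow> (int \<Rightarrow> 'x) \<Rightarrow> (int \<Rightarrow> 'u) \<Rightarrow> int \<Rightarrow> 'x" where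
  "predicted_state ft \<tau> xcl ut s = pred_sol ft s (s - int (\<tau> s)) (xcl (s - int (\<tau> s))) ut"

text \<open>The times \<open>k\<close> at which the prediction of the state at \<open>\<sigma> i\<close> evaluates its control sequence
  are \<open>\<sigma> i - \<tau> (\<sigma> i), \<dots>, \<sigma> i - 1\<close>.\<close>
definition prediction_consistent ::
  "(nat \<Rightarrow> int) \<Rightarrow> (int \<Rightarrow> nat) \<Rightarrow> (int \<Rightarrow> 'u) \<Rightarrow> (int \<Rightarrow> 'u) \<Rightarrow> bool" where
  "prediction_consistent \<sigma> \<tau> ut u \<longleftrightarrow>
     (\<forall>i. \<forall>k\<in>{\<sigma> i - int (\<tau> (\<sigma> i))..<\<sigma> i}. ut k = u k)"

definition closed_loop_trajectory ::
  "'x set \<Rightarrow> 'u set \<Rightarrow> 'w set \<Rightarrow> ('x \<Rightarrow> 'u \<Rightarrow> 'w \<Rightarrow> 'x) \<Rightarrow> ('x \<Rightarrow> 'u \<Rightarrow> 'x) \<Rightarrow> ('x \<Rightarrow> nat \<Rightarrow> 'u) \<Rightarrow>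
   (nat \<Rightarrow> int) \<Rightarrow> (int \<Rightarrow> nat) \<Rightarrow> 'x \<Rightarrow>
   (int \<Rightarrow> 'x) \<Rightarrow> (int \<Rightarrow> 'u) \<Rightarrow> (int \<Rightarrow> 'u) \<Rightarrow> (int \<Rightarrow> 'w) \<Rightarrow> bool" where
  "closed_loop_trajectory X U W f ft \<mu> \<sigma> \<tau> x0 xcl u ut w \<longleftrightarrow>
     (\<forall>n \<ge> - int (tau_inf \<sigma> \<tau>). xcl n \<in> X \<and> u n \<in> U \<and> w n \<in> W) \<and>
     xcl 0 = x0 \<and>
     (\<forall>n \<ge> - int (tau_inf \<sigma> \<tau>). xcl (n + 1) = f (xcl n) (u n) (w n)) \<and>
     (\<forall>i. \<forall>n\<in>{\<sigma> i..\<sigma> (Suc i) - 1}.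
        u n = \<mu> (predicted_state ft \<tau> xcl ut (\<sigma> i)) (nat (n - \<sigma> i)))"

definition aux_solution ::
  "('x \<Rightarrow> 'u \<Rightarrow> 'w \<Rightarrow> 'x) \<Rightarrow> ('x \<Rightarrow> nat \<Rightarrow> 'u) \<Rightarrow> (nat \<Rightarrow> int) \<Rightarrow>
   'x::plus \<Rightarrow> (int \<Rightarrow> 'x) \<Rightarrow> (int \<Rightarrow> 'w) \<Rightarrow> (int \<Rightarrow> 'x) \<Rightarrow> bool" where
  "aux_solution f \<mu> \<sigma> x0 v w xa \<longleftrightarrow>
     xa 0 = x0 \<and>
     (\<forall>i. \<forall>n\<in>{\<sigma> i..\<sigma> (Suc i) - 1}.
        xa (n + 1) = f (xa n) (\<mu> (xa (\<sigma> i) + v (\<sigma> i)) (nat (n - \<sigma> i))) (w n))"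

definition admissible_error ::
  "'x set \<Rightarrow> ('x \<Rightarrow> 'u \<Rightarrow> 'x) \<Rightarrow> ('x \<Rightarrow> nat \<Rightarrow> 'u) \<Rightarrow> (nat \<Rightarrow> int) \<Rightarrow>
   (int \<Rightarrow> 'x::ab_group_add) \<Rightarrow> (int \<Rightarrow> 'x) \<Rightarrow> bool" where
  "admissible_error X ft \<mu> \<sigma> xa v \<longleftrightarrow>
     (\<forall>i. xa (\<sigma> i) + v (\<sigma> i) \<in> X) \<and>
     (\<forall>i. \<forall>n\<in>{\<sigma> i<..<\<sigma> (Suc i)}.
        v n = pred_sol ft n (\<sigma> i) (xa (\<sigma> i) + v (\<sigma> i))
                (\<lambda>k. \<mu> (xa (\<sigma> i) + v (\<sigma> i)) (nat (k - \<sigma> i))) - xa n)"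

end

theory Submission
  imports Defs
begin

text \<open>
  A closed loop trajectory is itself a solution of the auxiliary system. On \<open>[\<sigma> i, \<sigma> (Suc i))\<close> take as
  measurement error the difference between the prediction started at the measurement time
  \<open>\<sigma> i - \<tau> (\<sigma> i)\<close> and the actual state. Prediction consistency makes this error admissible: by the
  semigroup property, continuing the prediction beyond \<open>\<sigma> i\<close> with the applied inputs is the same as
  predicting afresh from the predicted state at \<open>\<sigma> i\<close>. The prediction starts from the exact state and
  runs over at most \<open>\<tau>\<^sub>\<infinity> + \<Delta>\<^sub>\<infinity>\<close> steps, so the error is at most \<open>\<epsilon>(\<cdot>, 0) + \<eta>(\<cdot>, \<parallel>w\<parallel>)\<close>, and ISS applies.
\<close>

lemma iterate_cong:
  assumes "\<And>j x. j < k \<Longrightarrow> g (n0 + int j) x = h (n0 + int j) x"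
  shows "iterate g n0 x k = iterate h n0 x k"
  using assms by (induction k) auto

text \<open>The system is time-varying, so a restart after \<open>j\<close> steps must also move the
  initial time to \<open>n0 + int j\<close>.\<close>

lemma iterate_add:
  "iterate g (n0 + int j) (iterate g n0 x j) k = iterate g n0 x (j + k)"
  by (induction k) (auto simp: add.assoc)

lemma iterate_in:
  assumes "x \<in> X" and "\<And>j x. j < k \<Longrightarrow> x \<in> X \<Longrightarrow> g (n0 + int j) x \<in> X"
  shows "iterate g n0 x k \<in> X"
  using assms(2) by (induction k) (auto simp: assms(1))

text \<open>Links sequences given by a recursion to explicit iterates. The recursion is demanded
  only on the window actually traversed, which suits trajectories that are constrained only from
  some time on.\<close>

lemma iterate_trajectory:
  assumes "\<And>j. j < k \<Longrightarrow> y (n0 + int j + 1) = g (n0 + int j) (y (n0 + int j))"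
  shows "iterate g n0 (y n0) k = y (n0 + int k)"
  using assms
proof (induction k)
  case (Suc k)
  then show ?case using Suc.prems[of k] by (simp add: add.assoc add.commute[of 1])
qed simp

lemma pred_sol_refl [simp]: "pred_sol ft n n x u = x"
  by (simp add: pred_sol_def)

lemma pred_sol_cong:
  assumes "\<And>k. n0 \<le> k \<Longrightarrow> k < n \<Longrightarrow> u k = u' k"
  shows "pred_sol ft n n0 x u = pred_sol ft n n0 x u'"
  unfolding pred_sol_def by (rule iterate_cong) (use assms in auto)

text \<open>The step counts before and after \<open>s\<close> add up, so \<open>iterate_add\<close>
  applies. This allows a delayed prediction to be restarted at a switching time.\<close>

lemma pred_sol_compose:
  assumes "n0 \<le> s" "s \<le> n"
  shows "pred_sol ft n s (pred_sol ft s n0 x u) u = pred_sol ft n n0 x u"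
proof -
  have "s = n0 + int (nat (s - n0))" "nat (n - n0) = nat (s - n0) + nat (n - s)"
    using assms by auto
  then show ?thesis
    unfolding pred_sol_def by (metis iterate_add)
qed

lemma pred_sol_in:
  assumes "x \<in> X" and "\<forall>x\<in>X. \<forall>u\<in>U. ft x u \<in> X"
    and "\<And>k. n0 \<le> k \<Longrightarrow> k < n \<Longrightarrow> u k \<in> U"
  shows "pred_sol ft n n0 x u \<in> X"
  unfolding pred_sol_def by (rule iterate_in) (use assms in auto)

lemma plant_sol_trajectory:
  assumes "n0 \<le> n"
    and "\<And>k. n0 \<le> k \<Longrightarrow> k < n \<Longrightarrow> y (k + 1) = f (y k) (u k) (w k)"
  shows "plant_sol f n n0 (y n0) u w = y n"
proof -
  have "iterate (\<lambda>k x. f x (u k) (w k)) n0 (y n0) (nat (n - n0)) = y (n0 + int (nat (n - n0)))"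
    by (rule iterate_trajectory) (use assms in auto)
  then show ?thesis
    using assms(1) by (simp add: plant_sol_def)
qed

lemma sup_norm_mono:
  assumes "bounded (z ` T)" "S \<subseteq> T" "S \<noteq> {}"
  shows "sup_norm S z \<le> sup_norm T z"
proof -
  have "bdd_above ((\<lambda>n. norm (z n)) ` T)"
    using assms(1) by (auto simp: bounded_iff bdd_above_def)
  then show ?thesis
    unfolding sup_norm_def using assms by (intro cSUP_subset_mono) auto
qed

lemma sup_norm_le:
  assumes "T \<noteq> {}" "\<And>n. n \<in> T \<Longrightarrow> norm (z n) \<le> B"
  shows "sup_norm T z \<le> B"
  unfolding sup_norm_def using assms by (intro cSUP_least) auto

text \<open>Any single norm is a lower bound for the supremum once the latter is genuine, that is,
  over a nonempty bounded set. Comparison functions are monotone only on \<open>{0..}\<close>, hence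
  the interest in nonnegativity.\<close>

lemma sup_norm_nonneg:
  assumes "bounded (z ` T)" "T \<noteq> {}"
  shows "0 \<le> sup_norm T z"
proof -
  have "bdd_above ((\<lambda>n. norm (z n)) ` T)"
    using assms(1) by (auto simp: bounded_iff bdd_above_def)
  moreover obtain n where "n \<in> T"
    using assms(2) by auto
  ultimately have "norm (z n) \<le> sup_norm T z"
    unfolding sup_norm_def by (rule cSUP_upper[rotated])
  then show ?thesis
    by (rule order_trans[OF norm_ge_zero])
qed

lemma class_K_inf_mono:
  assumes "class_K_inf \<gamma>" "0 \<le> a" "a \<le> b"
  shows "\<gamma> a \<le> \<gamma> b"
proof -
  have "strict_mono_on {0..} \<gamma>"
    using assms(1) by (simp add: class_K_inf_def class_K_def)
  then show ?thesis
    using assms by (auto simp: strict_mono_on_leD)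
qed

lemma le_tau_inf:
  assumes "bounded_delays \<sigma> \<tau>"
  shows "\<tau> (\<sigma> i) \<le> tau_inf \<sigma> \<tau>"
proof -
  have "finite (range (\<lambda>i. \<tau> (\<sigma> i)))"
    using assms by (simp add: bounded_delays_def bdd_above_nat)
  then show ?thesis
    by (simp add: tau_inf_def)
qed

lemma admissible_switching_step:
  assumes "admissible_switching m \<sigma>"
  shows "\<sigma> i < \<sigma> (Suc i)"
  using assms by (simp add: admissible_switching_def strict_mono_Suc_iff)

lemma admissible_switching_nonneg:
  assumes "admissible_switching m \<sigma>"
  shows "0 \<le> \<sigma> i"
proof -
  have "\<sigma> 0 \<le> \<sigma> i"
    using assms strict_mono_less_eq[of \<sigma> 0 i] unfolding admissible_switching_def by blast
  then show ?thesis
    using assms by (simp add: admissible_switching_def)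
qed

lemma le_delta_inf:
  assumes "admissible_switching m \<sigma>"
  shows "\<sigma> (Suc i) - \<sigma> i \<le> delta_inf \<sigma>"
proof -
  have "range (\<lambda>i. \<sigma> (Suc i) - \<sigma> i) \<subseteq> {0..int m}"
    using assms admissible_switching_step[OF assms]
    by (auto simp: admissible_switching_def less_imp_le)
  then have "finite (range (\<lambda>i. \<sigma> (Suc i) - \<sigma> i))"
    by (rule finite_subset) simp
  then show ?thesis
    by (simp add: delta_inf_def)
qed

text \<open>Integer switching times grow at least like their index, so some switching time exceeds
  \<open>n\<close>; the predecessor of the least such index is the one sought.\<close>

lemma switching_interval_exists:
  assumes "admissible_switching m \<sigma>" "0 \<le> n"
  obtains i where "\<sigma> i \<le> n" "n < \<sigma> (Suc i)"
proof -
  have "int i \<le> \<sigma> i" for i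
  proof (induction i)
    case (Suc i)
    then show ?case
      using admissible_switching_step[OF assms(1), of i] by simp
  qed (use assms in \<open>simp add: admissible_switching_def\<close>)
  from this[of "Suc (nat n)"] have "n < \<sigma> (Suc (nat n))"
    using assms(2) by simp
  then have least: "n < \<sigma> (LEAST i. n < \<sigma> i)" (is "_ < \<sigma> ?i")
    by (rule LeastI)
  \<comment> \<open>The least index has a predecessor because \<open>\<sigma> 0 = 0\<close> does not
    exceed \<open>n\<close>.\<close>
  moreover have "?i \<noteq> 0"
  proof
    assume "?i = 0"
    with least have "n < \<sigma> 0"
      by simp
    with assms show False
      by (simp add: admissible_switching_def)
  qed
  then obtain i where i: "?i = Suc i"
    by (cases ?i) auto
  moreover have "\<not> n < \<sigma> i"
    by (rule not_less_Least) (simp add: i)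
  ultimately show thesis
    using that[of i] by simp
qed

lemma switching_interval_unique:
  assumes "admissible_switching m \<sigma>"
    and "\<sigma> i \<le> n" "n < \<sigma> (Suc i)" "\<sigma> j \<le> n" "n < \<sigma> (Suc j)"
  shows "i = j"
proof -
  have sm: "strict_mono \<sigma>"
    using assms(1) by (simp add: admissible_switching_def)
  have "i < Suc j" "j < Suc i"
    using assms(2-5) strict_mono_less[OF sm, of i "Suc j"] strict_mono_less[OF sm, of j "Suc i"]
    by simp_all
  then show ?thesis
    by simp
qed

theorem theorem3p5:
  fixes X :: "(real ^ 'd) set" and U :: "(real ^ 'l) set" and W :: "'w::real_normed_vector set"
    and f :: "real ^ 'd \<Rightarrow> real ^ 'l \<Rightarrow> 'w \<Rightarrow> real ^ 'd"
    and ft :: "real ^ 'd \<Rightarrow> real ^ 'l \<Rightarrow> real ^ 'd"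
    and m :: nat and \<mu> :: "real ^ 'd \<Rightarrow> nat \<Rightarrow> real ^ 'l"
    and \<epsilon> \<eta> \<beta> :: "real \<Rightarrow> real \<Rightarrow> real" and \<gamma>w \<gamma>v :: "real \<Rightarrow> real"
  assumes W0: "0 \<in> W" and m: "m > 1"
    and f: "\<forall>x\<in>X. \<forall>u\<in>U. \<forall>w\<in>W. f x u w \<in> X"
    and ft: "\<forall>x\<in>X. \<forall>u\<in>U. ft x u \<in> X"
    and mu: "\<forall>x\<in>X. \<forall>j<m. \<mu> x j \<in> U"
    and eps_nonneg: "\<forall>r\<ge>0. \<forall>s\<ge>0. \<epsilon> r s \<ge> 0"
    and eps_cont: "continuous_on ({0..} \<times> {0..}) (\<lambda>(r, s). \<epsilon> r s)"
    and eps_mono1: "\<forall>s\<ge>0. mono_on {0..} (\<lambda>r. \<epsilon> r s)"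
    and eps_mono2: "\<forall>r\<ge>0. mono_on {0..} (\<epsilon> r)"
    and eps_bound: "\<forall>n n0 :: int. \<forall>x0\<in>X. \<forall>xt0\<in>X. \<forall>u :: int \<Rightarrow> real ^ 'l.
          n \<ge> n0 \<longrightarrow> (\<forall>k. u k \<in> U) \<longrightarrow>
          norm (pred_sol ft n n0 xt0 u - plant_sol f n n0 x0 u (\<lambda>_. 0))
            \<le> \<epsilon> (of_int (n - n0)) (norm (xt0 - x0))"
    and eta_nonneg: "\<forall>r\<ge>0. \<forall>s\<ge>0. \<eta> r s \<ge> 0"
    and eta_cont: "continuous_on ({0..} \<times> {0..}) (\<lambda>(r, s). \<eta> r s)"
    and eta_mono: "\<forall>s\<ge>0. mono_on {0..} (\<lambda>r. \<eta> r s)"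
    and eta_K: "\<forall>r\<ge>0. class_K (\<eta> r)"
    and eta_bound: "\<forall>n n0 :: int. \<forall>x0\<in>X. \<forall>(u :: int \<Rightarrow> real ^ 'l) (w :: int \<Rightarrow> 'w).
          n \<ge> n0 \<longrightarrow> (\<forall>k. u k \<in> U) \<longrightarrow> (\<forall>k. w k \<in> W) \<longrightarrow> bounded (range w) \<longrightarrow>
          norm (plant_sol f n n0 x0 u (\<lambda>_. 0) - plant_sol f n n0 x0 u w)
            \<le> \<eta> (of_int (n - n0)) (sup_norm UNIV w)"
    and beta: "class_KL \<beta>" and gamma_w: "class_K_inf \<gamma>w" and gamma_v: "class_K_inf \<gamma>v"
    and iss: "\<forall>x0\<in>X. \<forall>\<sigma> w v xa.
          admissible_switching m \<sigma> \<longrightarrow> (\<forall>n\<ge>0. w n \<in> W) \<longrightarrow>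
          aux_solution f \<mu> \<sigma> x0 v w xa \<longrightarrow> admissible_error X ft \<mu> \<sigma> xa v \<longrightarrow>
          bounded (w ` {0..}) \<longrightarrow> bounded (v ` {0..}) \<longrightarrow>
          (\<forall>n::nat. norm (xa (int n))
             \<le> Max {\<beta> (norm x0) (real n), \<gamma>w (sup_norm {0..} w), \<gamma>v (sup_norm {0..} v)})"
  shows "\<forall>x0\<in>X. \<forall>\<sigma> \<tau> xcl u ut w.
          admissible_switching m \<sigma> \<longrightarrow> bounded_delays \<sigma> \<tau> \<longrightarrow>
          closed_loop_trajectory X U W f ft \<mu> \<sigma> \<tau> x0 xcl u ut w \<longrightarrow>
          prediction_consistent \<sigma> \<tau> ut u \<longrightarrow>
          bounded (w ` {- int (tau_inf \<sigma> \<tau>)..}) \<longrightarrow>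
          (\<forall>n::nat. norm (xcl (int n))
             \<le> Max {\<beta> (norm x0) (real n),
                    \<gamma>w (sup_norm {- int (tau_inf \<sigma> \<tau>)..} w),
                    \<gamma>v (\<epsilon> (real (tau_inf \<sigma> \<tau>) + of_int (delta_inf \<sigma>)) 0 +
                        \<eta> (real (tau_inf \<sigma> \<tau>) + of_int (delta_inf \<sigma>))
                          (sup_norm {- int (tau_inf \<sigma> \<tau>)..} w))})"
proof (intro ballI allI impI)
  fix x0 \<sigma> \<tau> xcl u ut and w :: "int \<Rightarrow> 'w" and n :: nat
  assume "x0 \<in> X"
    and sw: "admissible_switching m \<sigma>" and bd: "bounded_delays \<sigma> \<tau>"
    and cl: "closed_loop_trajectory X U W f ft \<mu> \<sigma> \<tau> x0 xcl u ut w"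
    and pc: "prediction_consistent \<sigma> \<tau> ut u"
    and bw: "bounded (w ` {- int (tau_inf \<sigma> \<tau>)..})"
  define T where "T = - int (tau_inf \<sigma> \<tau>)"
  define L where "L = real (tau_inf \<sigma> \<tau>) + of_int (delta_inf \<sigma>)"
  define \<omega> where "\<omega> = sup_norm {T..} w"
  have bw: "bounded (w ` {T..})"
    using bw by (simp add: T_def)
  have T0: "T \<le> 0"
    by (simp add: T_def)
  have inX: "xcl k \<in> X" and inU: "u k \<in> U" and inW: "w k \<in> W"
    and step: "xcl (k + 1) = f (xcl k) (u k) (w k)" if "T \<le> k" for k
    using cl that by (auto simp: closed_loop_trajectory_def T_def)
  have xcl0: "xcl 0 = x0"
    using cl by (simp add: closed_loop_trajectory_def)
  have uin: "u k = \<mu> (predicted_state ft \<tau> xcl ut (\<sigma> i)) (nat (k - \<sigma> i))"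
    if "\<sigma> i \<le> k" "k < \<sigma> (Suc i)" for i k
    using cl that by (auto simp: closed_loop_trajectory_def)

  define t where "t i = \<sigma> i - int (\<tau> (\<sigma> i))" for i
  \<comment> \<open>Measurement times may be negative, but they never precede \<open>T\<close>,
    where the trajectory starts.\<close>
  have tT: "T \<le> t i" and t_le: "t i \<le> \<sigma> i" for i
    using le_tau_inf[OF bd, of i] admissible_switching_nonneg[OF sw, of i] by (auto simp: t_def T_def)
  \<comment> \<open>The horizon splits into the delay \<open>\<tau> (\<sigma> i)\<close> and the
    time elapsed since the switch at \<open>\<sigma> i\<close>.\<close>
  have len: "of_int (k - t i) \<le> L" if "k < \<sigma> (Suc i)" for i k
  proof -
    have "k - t i \<le> int (tau_inf \<sigma> \<tau>) + delta_inf \<sigma>"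
      using that le_tau_inf[OF bd, of i] le_delta_inf[OF sw, of i] by (simp add: t_def)
    then have "real_of_int (k - t i) \<le> of_int (int (tau_inf \<sigma> \<tau>) + delta_inf \<sigma>)"
      by (rule of_int_le_iff[THEN iffD2])
    then show ?thesis
      by (simp add: L_def)
  qed

  \<comment> \<open>This prediction is driven by the applied inputs \<open>u\<close>, not by
    \<open>ut\<close>, and is continued beyond \<open>\<sigma> i\<close>.\<close>
  define p where "p i k = pred_sol ft k (t i) (xcl (t i)) u" for i k
  \<comment> \<open>Prediction consistency enters here: \<open>ut\<close> and \<open>u\<close> agree
    between measurement and switch.\<close>
  have p_switch: "predicted_state ft \<tau> xcl ut (\<sigma> i) = p i (\<sigma> i)" for i
    unfolding predicted_state_def p_def t_def
    by (rule pred_sol_cong) (use pc in \<open>auto simp: prediction_consistent_def\<close>)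
  \<comment> \<open>For \<open>k < t i\<close> the step count is truncated to zero, so the value is
    the measured state itself.\<close>
  have pX: "p i k \<in> X" for i k
    unfolding p_def by (rule pred_sol_in[OF inX[OF tT] ft]) (meson inU tT order_trans)

  \<comment> \<open>The bounds on prediction errors and perturbations ask for sequences with values in \<open>U\<close> and \<open>W\<close>
    at all times, so the sequences are frozen before time \<open>T\<close>; this does not change the supremum.\<close>
  define u' where "u' k = u (max k T)" for k
  define w' where "w' k = w (max k T)" for k
  have rw: "range w' = w ` {T..}"
  proof
    show "w ` {T..} \<subseteq> range w'"
    proof
      fix y assume "y \<in> w ` {T..}"
      then obtain k where "T \<le> k" "y = w k"
        by auto
      then show "y \<in> range w'"
        by (intro image_eqI[of _ _ k]) (auto simp: w'_def)
    qed
  qed (auto simp: w'_def)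
  \<comment> \<open>The supremum depends only on the set of values, which freezing
    preserves.\<close>
  have sw': "sup_norm UNIV w' = \<omega>"
    using arg_cong[OF rw, of "\<lambda>S. Sup (norm ` S)"]
    by (simp add: \<omega>_def sup_norm_def image_image)
  have omega0: "0 \<le> \<omega>"
    unfolding \<omega>_def by (rule sup_norm_nonneg[OF bw]) auto
  have p_err: "norm (p i k - xcl k) \<le> \<epsilon> L 0 + \<eta> L \<omega>"
    if k: "\<sigma> i \<le> k" "k < \<sigma> (Suc i)" for i k
  proof -
    \<comment> \<open>The unperturbed plant from the measured state separates the two error sources:
      model mismatch, bounded by \<open>\<epsilon>\<close> with zero initial discrepancy, and
      perturbation, bounded by \<open>\<eta>\<close>.\<close>
    let ?z = "plant_sol f k (t i) (xcl (t i)) u' (\<lambda>_. 0)"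
    have tk: "t i \<le> k"
      using t_le[of i] k by simp
    have L: "0 \<le> real_of_int (k - t i)" "real_of_int (k - t i) \<le> L"
      using tk len[OF k(2)] by simp_all
    have p': "p i k = pred_sol ft k (t i) (xcl (t i)) u'"
      unfolding p_def by (rule pred_sol_cong) (use tT[of i] in \<open>simp add: u'_def\<close>)
    have x': "plant_sol f k (t i) (xcl (t i)) u' w' = xcl k"
      by (rule plant_sol_trajectory[OF tk]) (use tT[of i] step in \<open>simp add: u'_def w'_def\<close>)
    have U': "\<forall>k. u' k \<in> U" and W': "\<forall>k. w' k \<in> W"
      by (simp_all add: u'_def w'_def inU inW)
    have "norm (p i k - ?z) \<le> \<epsilon> (of_int (k - t i)) 0"
      using eps_bound[rule_format, OF inX[OF tT] inX[OF tT] tk, of u' i i] U' by (simp add: p')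
    also have "\<dots> \<le> \<epsilon> L 0"
      using eps_mono1 L by (auto intro!: mono_onD[of "{0..}" "\<lambda>r. \<epsilon> r 0"])
    finally have 1: "norm (p i k - ?z) \<le> \<epsilon> L 0" .
    have "norm (?z - xcl k) \<le> \<eta> (of_int (k - t i)) \<omega>"
      using eta_bound[rule_format, OF inX[OF tT] tk, of u' w' i] U' W' bw by (simp add: x' sw' rw)
    also have "\<dots> \<le> \<eta> L \<omega>"
      using eta_mono L omega0 by (auto intro!: mono_onD[of "{0..}" "\<lambda>r. \<eta> r \<omega>"])
    finally have 2: "norm (?z - xcl k) \<le> \<eta> L \<omega>" .
    have "norm (p i k - xcl k) \<le> norm (p i k - ?z) + norm (?z - xcl k)"
      using norm_triangle_ineq[of "p i k - ?z" "?z - xcl k"] by simp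
    with 1 2 show ?thesis
      by linarith
  qed

  \<comment> \<open>Each \<open>k \<ge> 0\<close> lies in exactly one switching interval. For
    negative \<open>k\<close> there is none and the value is arbitrary; only times
    \<open>k \<ge> 0\<close> enter below.\<close>
  define v where "v k = p (THE i. \<sigma> i \<le> k \<and> k < \<sigma> (Suc i)) k - xcl k" for k
  have v: "v k = p i k - xcl k" if "\<sigma> i \<le> k" "k < \<sigma> (Suc i)" for i k
  proof -
    have "(THE i. \<sigma> i \<le> k \<and> k < \<sigma> (Suc i)) = i"
      by (rule the_equality) (use that switching_interval_unique[OF sw] in blast)+
    then show ?thesis
      by (simp add: v_def)
  qed
  have v_switch: "xcl (\<sigma> i) + v (\<sigma> i) = p i (\<sigma> i)" for i
    using v[of i "\<sigma> i"] admissible_switching_step[OF sw, of i] by simp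
  have v_bound: "norm (v k) \<le> \<epsilon> L 0 + \<eta> L \<omega>" if "0 \<le> k" for k
    using switching_interval_exists[OF sw that] v p_err by metis
  have bv: "bounded (v ` {0..})"
    using v_bound by (auto simp: bounded_iff)
  have aux: "aux_solution f \<mu> \<sigma> x0 v w xcl"
    unfolding aux_solution_def
  proof (intro conjI allI ballI)
    fix i k assume "k \<in> {\<sigma> i..\<sigma> (Suc i) - 1}"
    then have k: "\<sigma> i \<le> k" "k < \<sigma> (Suc i)"
      by auto
    have "T \<le> k"
      using tT[of i] t_le[of i] k by simp
    then show "xcl (k + 1) = f (xcl k) (\<mu> (xcl (\<sigma> i) + v (\<sigma> i)) (nat (k - \<sigma> i))) (w k)"
      using step uin[OF k] by (simp add: p_switch v_switch)
  qed (fact xcl0)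
  have adm: "admissible_error X ft \<mu> \<sigma> xcl v"
    unfolding admissible_error_def v_switch
  proof (intro conjI allI ballI)
    fix i k assume k: "k \<in> {\<sigma> i<..<\<sigma> (Suc i)}"
    \<comment> \<open>Split the long prediction at \<open>\<sigma> i\<close>; from there up to
      \<open>k\<close> the applied inputs are exactly those generated by \<open>\<mu>\<close> from
      the predicted state.\<close>
    have "p i k = pred_sol ft k (\<sigma> i) (p i (\<sigma> i)) u"
      unfolding p_def by (rule pred_sol_compose[symmetric]) (use k t_le in auto)
    also have "\<dots> = pred_sol ft k (\<sigma> i) (p i (\<sigma> i)) (\<lambda>j. \<mu> (p i (\<sigma> i)) (nat (j - \<sigma> i)))"
      by (rule pred_sol_cong) (use k uin[of i] in \<open>simp add: p_switch\<close>)
    finally show "v k = pred_sol ft k (\<sigma> i) (p i (\<sigma> i)) (\<lambda>j. \<mu> (p i (\<sigma> i)) (nat (j - \<sigma> i))) - xcl k"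
      using v[of i k] k by simp
  qed (fact pX)

  have T_sub: "{0..} \<subseteq> {T..}"
    using T0 by simp
  have bw0: "bounded (w ` {0..})"
    by (rule bounded_subset[OF bw image_mono[OF T_sub]])
  have "\<forall>k\<ge>0. w k \<in> W"
    using T0 inW by auto
  from iss[rule_format, OF \<open>x0 \<in> X\<close> sw this[rule_format] aux adm bw0 bv, of n]
  have "norm (xcl (int n)) \<le> Max {\<beta> (norm x0) (real n), \<gamma>w (sup_norm {0..} w), \<gamma>v (sup_norm {0..} v)}" .
  \<comment> \<open>ISS sees the perturbation from time 0 on, whereas \<omega> also covers the past
    from \<open>T\<close>, which influences the predictions.\<close>
  moreover have "\<gamma>w (sup_norm {0..} w) \<le> \<gamma>w \<omega>"
    unfolding \<omega>_def
    by (rule class_K_inf_mono[OF gamma_w sup_norm_nonneg[OF bw0] sup_norm_mono[OF bw T_sub]]) auto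
  moreover have "\<gamma>v (sup_norm {0..} v) \<le> \<gamma>v (\<epsilon> L 0 + \<eta> L \<omega>)"
    by (rule class_K_inf_mono[OF gamma_v sup_norm_nonneg[OF bv] sup_norm_le]) (auto simp: v_bound)
  ultimately have "norm (xcl (int n)) \<le> Max {\<beta> (norm x0) (real n), \<gamma>w \<omega>, \<gamma>v (\<epsilon> L 0 + \<eta> L \<omega>)}"
    by (auto simp: le_max_iff_disj)
  then show "norm (xcl (int n))
      \<le> Max {\<beta> (norm x0) (real n),
             \<gamma>w (sup_norm {- int (tau_inf \<sigma> \<tau>)..} w),
             \<gamma>v (\<epsilon> (real (tau_inf \<sigma> \<tau>) + of_int (delta_inf \<sigma>)) 0 +
                 \<eta> (real (tau_inf \<sigma> \<tau>) + of_int (delta_inf \<sigma>))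
                   (sup_norm {- int (tau_inf \<sigma> \<tau>)..} w))}"
    by (simp only: L_def \<omega>_def T_def)
qed

end
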